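(* For every integer $n\ge 0$, the number of invertible $(n+1)\times(n+1)$ Toeplitz matrices $\mathcal{A}_n$ over $GF(2)$ is $2^{2n}$, which is half of the total number of $(n+1)\times(n+1)$ Toeplitz matrices over $GF(2)$.
   Context: An $(n+1)\times(n+1)$ Toeplitz matrix $\mathcal{A}_n$ over $GF(2)$ is a matrix whose $(i,j)$ entry ($0\le i,j\le n$) is $a_{j-i}$ if $j\ge i$ and $b_{i-j}$ if $i>j$, where $a_0,\dots,a_n,b_1,\dots,b_n\in GF(2)$. *)

theory Defs
  imports "HOL-Library.Z2" "Jordan_Normal_Form.Matrix"
begin

text \<open>The field GF(2) is rendered by the type \<open>bit\<close>. The values \<open>a k\<close> and \<open>b k\<close> for
  \<open>k > n\<close>, as well as \<open>b 0\<close>, do not enter the matrix.\<close>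

definition toeplitz_mat :: "nat \<Rightarrow> (nat \<Rightarrow> 'a) \<Rightarrow> (nat \<Rightarrow> 'a) \<Rightarrow> 'a mat" where
  "toeplitz_mat n a b =
     mat (n + 1) (n + 1) (\<lambda>(i, j). if j \<ge> i then a (j - i) else b (i - j))"

text \<open>A set of matrices rather than of parameter pairs: parameters that differ only in
  unused values give the same element.\<close>

definition toeplitz_mats :: "nat \<Rightarrow> 'a mat set" where
  "toeplitz_mats n = {A. \<exists>a b. A = toeplitz_mat n a b}"

end

theory Submission
  imports Defs "Jordan_Normal_Form.Determinant"
begin

text \<open>
  A Toeplitz matrix of order \<open>n + 1\<close> is a sequence \<open>c\<close> of length \<open>2 n + 1\<close>. Identify column
  vectors with polynomials of degree at most \<open>n\<close>, and let \<open>c\<close> act on polynomials as the linear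
  functional sending \<open>x\<^sup>i\<close> to the \<open>i\<close>-th term of \<open>c\<close>. A vector \<open>v\<close> lies in the kernel of the
  matrix iff the functional kills \<open>x\<^sup>i v\<close> for all \<open>i \<le> n\<close>, that is, iff \<open>c\<close> satisfies the linear
  recurrence with coefficients \<open>v\<close> at \<open>n + 1\<close> consecutive places
  (\<open>toeplitz_of_mult_vec_eq_0_iff\<close>). So the sequences \<open>c\<close> whose kernel \<open>K(c)\<close> is nonzero have to
  be counted.

  It is easy to count pairs \<open>(c, v)\<close> with \<open>v\<close> a nonzero element of \<open>K(c)\<close>: for fixed \<open>v\<close>, the
  conditions on \<open>c\<close> are independent, because each involves one new term of \<open>c\<close>, the one
  multiplied by the leading coefficient of \<open>v\<close> (\<open>card_sequences_satisfying\<close>). This yields the sum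
  of \<open>|K(c)| - 1\<close> over all \<open>c\<close>, but counts a singular matrix with a multiplicity that depends on
  its nullity. The remedy is to compare with the space \<open>K'(c)\<close> of recurrences of degree less than
  \<open>n\<close> that hold at \<open>n + 2\<close> places, which is the kernel of the \<open>(n + 2) \<times> n\<close> Toeplitz matrix built
  from the same sequence. The crucial fact (\<open>card_recurrences_short\<close>) is that \<open>K'(c)\<close> has
  codimension exactly one in \<open>K(c)\<close> as soon as \<open>K(c)\<close> is nonzero. Over \<open>GF(2)\<close> this says
  \<open>|K(c)| = 2 |K'(c)|\<close>, so that

    \<open>(|K(c)| - 1) - 2 (|K'(c)| - 1)\<close>

  is \<open>1\<close> if the matrix is singular and \<open>0\<close> otherwise. Summing over \<open>c\<close>, the number of singular
  matrices is \<open>(2\<^bsup>n+1\<^esup> - 1) 2\<^sup>n - (2\<^sup>n - 1) 2\<^sup>n = 2\<^bsup>2n\<^esup>\<close>, half of the \<open>2\<^bsup>2n+1\<^esup>\<close> Toeplitz matrices.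
\<close>

section \<open>Sequences as functionals on polynomials\<close>

text \<open>
  The polynomial \<open>c\<close> stands for its coefficient sequence; representing sequences and vectors by the
  same type lets one cardinality computation serve for both.
\<close>

definition pairing :: "'a::comm_ring_1 poly \<Rightarrow> 'a poly \<Rightarrow> 'a" where
  "pairing c p = (\<Sum>i\<le>degree p. coeff c i * coeff p i)"

lemma pairing_eq_sum:
  assumes "degree p \<le> N"
  shows "pairing c p = (\<Sum>i\<le>N. coeff c i * coeff p i)"
  unfolding pairing_def
  by (rule sum.mono_neutral_left) (use assms in \<open>auto simp: coeff_eq_0\<close>)

lemma pairing_add_left: "pairing (c + d) p = pairing c p + pairing d p"
  by (simp add: pairing_def sum.distrib distrib_right)

lemma pairing_monom_left: "pairing (monom 1 k) p = coeff p k"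
proof -
  have "pairing (monom 1 k) p = (\<Sum>i\<le>max k (degree p). coeff (monom 1 k) i * coeff p i)"
    by (rule pairing_eq_sum) simp
  also have "\<dots> = (\<Sum>i\<le>max k (degree p). if i = k then coeff p i else 0)"
    by (rule sum.cong) auto
  finally show ?thesis by simp
qed

lemma pairing_zero_right [simp]: "pairing c 0 = 0"
  by (simp add: pairing_def)

lemma pairing_add_right: "pairing c (p + q) = pairing c p + pairing c q"
proof -
  define N where "N = max (degree p) (degree q)"
  have "degree (p + q) \<le> N" "degree p \<le> N" "degree q \<le> N"
    by (auto simp: N_def degree_add_le_max)
  then show ?thesis
    by (simp add: pairing_eq_sum sum.distrib distrib_left)
qed

lemma pairing_smult_right: "pairing c (smult a p) = a * pairing c p"
proof -
  have "degree (smult a p) \<le> degree p" by (rule degree_smult_le)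
  then show ?thesis
    by (simp add: pairing_eq_sum[of _ "degree p"] sum_distrib_left ac_simps)
qed

lemma pairing_sum_right: "pairing c (\<Sum>i\<in>I. f i) = (\<Sum>i\<in>I. pairing c (f i))"
  by (induction I rule: infinite_finite_induct) (auto simp: pairing_add_right)

text \<open>
  If the functional vanishes on all shifts \<open>x\<^sup>i u\<close> up to the degree of \<open>w\<close>, it vanishes on the product
  \<open>w u\<close>. Reading such a product from either factor is what makes the codimension argument below
  work.
\<close>

lemma pairing_mult:
  "pairing c (w * u) = (\<Sum>i\<le>degree w. coeff w i * pairing c (monom 1 i * u))"
proof -
  have "w * u = (\<Sum>i\<le>degree w. smult (coeff w i) (monom 1 i * u))"
  proof -
    have "w * u = (\<Sum>i\<le>degree w. monom (coeff w i) i) * u"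
      by (simp add: poly_as_sum_of_monoms)
    also have "\<dots> = (\<Sum>i\<le>degree w. smult (coeff w i) (monom 1 i * u))"
      unfolding sum_distrib_right
      by (rule sum.cong) (auto simp flip: mult_smult_left simp: smult_monom)
    finally show ?thesis .
  qed
  then show ?thesis by (simp add: pairing_sum_right pairing_smult_right)
qed

section \<open>Spaces of linear recurrences\<close>

text \<open>
  Bounding coefficients instead of \<open>degree\<close> makes this the space of dimension \<open>j\<close> also for \<open>j = 0\<close>,
  where \<open>degree v < j\<close> would exclude even the zero polynomial.
\<close>

definition polys_below :: "nat \<Rightarrow> 'a::zero poly set" where
  "polys_below j = {v. \<forall>i\<ge>j. coeff v i = 0}"

text \<open>
  These are the kernels of the \<open>k \<times> j\<close> matrices with entries \<open>c\<^bsub>i+l\<^esub>\<close>. Two instances matter: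
  \<open>(j, k) = (n + 1, n + 1)\<close> gives \<open>K(c)\<close>, and \<open>(j, k) = (n, n + 2)\<close> gives \<open>K'(c)\<close>, whose elements are
  called short. In both cases \<open>j + k = 2 n + 2\<close>, so that no term of \<open>c\<close> beyond \<open>c\<^bsub>2n\<^esub>\<close> is involved.
\<close>

definition recurrences :: "nat \<Rightarrow> nat \<Rightarrow> 'a::comm_ring_1 poly \<Rightarrow> 'a poly set" where
  "recurrences j k c = {v \<in> polys_below j. \<forall>i<k. pairing c (monom 1 i * v) = 0}"

lemma polys_below_iff_top_zero:
  "v \<in> polys_below n \<longleftrightarrow> v \<in> polys_below (Suc n) \<and> coeff v n = 0"
proof -
  have "(\<forall>i\<ge>n. coeff v i = 0) \<longleftrightarrow> (\<forall>i\<ge>Suc n. coeff v i = 0) \<and> coeff v n = 0"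
  proof (intro iffI conjI allI impI)
    fix i
    assume *: "(\<forall>i\<ge>Suc n. coeff v i = 0) \<and> coeff v n = 0" and "n \<le> i"
    from \<open>n \<le> i\<close> have "i = n \<or> Suc n \<le> i" by linarith
    with * show "coeff v i = 0" by blast
  qed auto
  then show ?thesis by (simp add: polys_below_def)
qed

lemma degree_less_polys_below: "v \<in> polys_below j \<Longrightarrow> v \<noteq> 0 \<Longrightarrow> degree v < j"
  using leading_coeff_neq_0[of v] by (auto simp: polys_below_def not_le[symmetric])

lemma zero_in_polys_below [simp]: "0 \<in> polys_below j"
  by (simp add: polys_below_def)

lemma zero_in_recurrences [simp]: "0 \<in> recurrences j k c"
  by (simp add: recurrences_def)

lemma recurrences_add:
  "u \<in> recurrences j k c \<Longrightarrow> v \<in> recurrences j k c \<Longrightarrow> u + v \<in> recurrences j k c"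
  by (auto simp: recurrences_def polys_below_def distrib_left pairing_add_right)

lemma recurrences_short_iff:
  "v \<in> recurrences n (n + 2) c \<longleftrightarrow>
     v \<in> recurrences (n + 1) (n + 1) c \<and> coeff v n = 0 \<and> pairing c (monom 1 (n + 1) * v) = 0"
  by (auto simp: recurrences_def polys_below_iff_top_zero[of v n] less_Suc_eq)

lemma monom_mult_recurrences:
  assumes "v \<in> recurrences n (n + 2) c"
  shows "monom 1 1 * v \<in> recurrences (n + 1) (n + 1) c"
proof -
  have "monom 1 i * (monom 1 1 * v) = monom 1 (i + 1) * v" for i
    by (simp add: mult_monom flip: mult.assoc)
  with assms show ?thesis
    by (auto simp: recurrences_def polys_below_def coeff_monom_mult)
qed

text \<open>
  If all of \<open>K(c)\<close> were short, \<open>K(c)\<close> would be closed under multiplication by \<open>x\<close>, so that a nonzero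
  element would produce elements of unbounded degree.
\<close>

lemma recurrences_not_all_short:
  fixes c :: "'a::idom poly"
  assumes "recurrences (n + 1) (n + 1) c \<noteq> {0}"
  shows "\<not> recurrences (n + 1) (n + 1) c \<subseteq> recurrences n (n + 2) c"
proof
  assume sub: "recurrences (n + 1) (n + 1) c \<subseteq> recurrences n (n + 2) c"
  from assms obtain v where v: "v \<in> recurrences (n + 1) (n + 1) c" "v \<noteq> 0"
    using zero_in_recurrences[of "n + 1" "n + 1" c] by blast
  have "monom 1 i * v \<in> recurrences (n + 1) (n + 1) c" for i
  proof (induction i)
    case 0
    then show ?case using v by (simp add: monom_0 one_pCons[symmetric])
  next
    case (Suc i)
    have "monom 1 (Suc i) * v = monom 1 1 * (monom 1 i * v)"
      by (simp add: mult_monom flip: mult.assoc)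
    with monom_mult_recurrences[of "monom 1 i * v"] Suc sub show ?case by (metis subsetD)
  qed
  from this[of "n + 1"] have "monom 1 (n + 1) * v \<in> polys_below (n + 1)"
    by (simp add: recurrences_def)
  then have "degree (monom 1 (n + 1) * v) < n + 1"
    using v(2) by (intro degree_less_polys_below) auto
  then show False
    using v(2) by (simp add: degree_mult_eq degree_monom_eq)
qed

text \<open>
  An element of \<open>K(c)\<close> of degree less than \<open>n\<close> must satisfy one further condition to be short. If
  \<open>K(c)\<close> contains some \<open>v\<close> of full degree \<open>n\<close>, the condition is automatic: evaluate the functional
  on \<open>x w v\<close> in two ways. As a combination of the \<open>x\<^sup>i v\<close> with \<open>i \<le> n\<close> the value is zero; as a
  combination of the \<open>x\<^sup>i w\<close>, all terms but the one with \<open>i = n + 1\<close> vanish.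
\<close>

lemma recurrences_short_if_long_exists:
  fixes c :: "'a::idom poly"
  assumes v: "v \<in> recurrences (n + 1) (n + 1) c" "coeff v n \<noteq> 0"
    and w: "w \<in> recurrences (n + 1) (n + 1) c" "coeff w n = 0"
  shows "w \<in> recurrences n (n + 2) c"
proof -
  have v': "pairing c (monom 1 i * v) = 0" if "i \<le> n" for i
    using v that by (simp add: recurrences_def)
  have w': "pairing c (monom 1 i * w) = 0" if "i \<le> n" for i
    using w that by (simp add: recurrences_def)
  have degv: "degree v = n"
  proof (rule antisym)
    have "v \<noteq> 0" using v(2) by auto
    with v(1) show "degree v \<le> n"
      using degree_less_polys_below[of v "n + 1"] by (simp add: recurrences_def)
  qed (use v(2) in \<open>rule le_degree\<close>)
  have "degree (monom 1 1 * w) \<le> n"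
  proof (cases "w = 0")
    case False
    moreover have "w \<in> polys_below n"
      using w by (simp add: recurrences_def polys_below_iff_top_zero[of w n])
    ultimately show ?thesis
      using degree_less_polys_below[of w n] by (simp add: degree_mult_eq degree_monom_eq)
  qed auto
  then have "pairing c ((monom 1 1 * w) * v) = 0"
    unfolding pairing_mult[of c "monom 1 1 * w"] by (intro sum.neutral) (auto simp: v')
  then have "0 = pairing c (monom 1 1 * v * w)"
    by (simp add: ac_simps)
  also have "degree (monom 1 1 * v) = n + 1"
    using v degv by (subst degree_mult_eq) (auto simp: degree_monom_eq)
  then have "pairing c (monom 1 1 * v * w) =
      (\<Sum>i\<le>n + 1. coeff (monom 1 1 * v) i * pairing c (monom 1 i * w))"
    by (subst pairing_mult) simp
  also have "\<dots> = coeff v n * pairing c (monom 1 (n + 1) * w)"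
    using w' by (simp add: coeff_monom_mult)
  finally show ?thesis
    using v w recurrences_short_iff[of w n c] by simp
qed

section \<open>Counting over GF(2)\<close>

text \<open>
  This takes the place of rank computations: imposing a linear condition that some translation of
  the space violates halves the number of elements. The map \<open>g\<close> will always be a translation, which
  is an involution because the characteristic is two.
\<close>

lemma card_eq_twice_if_swapped:
  assumes "finite S" and "\<And>x. x \<in> S \<Longrightarrow> g x \<in> S" and "\<And>x. x \<in> S \<Longrightarrow> g (g x) = x"
    and "\<And>x. x \<in> S \<Longrightarrow> P (g x) \<longleftrightarrow> \<not> P x"
  shows "card S = 2 * card {x \<in> S. P x}"
proof -
  have "bij_betw g {x \<in> S. P x} {x \<in> S. \<not> P x}"
    by (rule bij_betw_byWitness[where f' = g]) (use assms in auto)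
  then have "card {x \<in> S. P x} = card {x \<in> S. \<not> P x}"
    by (rule bij_betw_same_card)
  moreover have "card S = card ({x \<in> S. P x} \<union> {x \<in> S. \<not> P x})"
    by (rule arg_cong[where f = card]) auto
  ultimately show ?thesis
    using assms(1) by (subst (asm) card_Un_disjoint) auto
qed

lemma bit_poly_add_add_self: "(p :: bit poly) + q + q = p"
proof (rule poly_eqI)
  show "coeff (p + q + q) i = coeff p i" for i
    unfolding coeff_add by (cases "coeff p i"; cases "coeff q i") simp_all
qed

lemma finite_card_polys_below:
  "finite (polys_below j :: bit poly set) \<and> card (polys_below j :: bit poly set) = 2 ^ j"
proof (induction j)
  case 0
  have "polys_below 0 = {0 :: bit poly}"
    by (auto simp: polys_below_def poly_eq_iff)
  then show ?case by simp
next
  case (Suc j)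
  let ?g = "\<lambda>p :: bit poly. p + monom 1 j"
  have part: "{p \<in> polys_below (Suc j). coeff p j = 0} = (polys_below j :: bit poly set)"
    using polys_below_iff_top_zero[of _ j] by blast
  have closed: "?g p \<in> polys_below (Suc j)" if "p \<in> polys_below (Suc j)" for p
    using that by (auto simp: polys_below_def)
  have "p \<in> polys_below j \<union> ?g ` polys_below j" if "p \<in> polys_below (Suc j)" for p
  proof (cases "coeff p j = 0")
    case True
    then show ?thesis using that part by auto
  next
    case False
    then have "coeff (?g p) j = 0" by simp
    with closed[OF that] have "?g p \<in> polys_below j"
      using polys_below_iff_top_zero[of "?g p" j] by simp
    moreover have "p = ?g (?g p)" by (simp only: bit_poly_add_add_self)
    ultimately show ?thesis by (intro UnI2 image_eqI[of p ?g "?g p"])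
  qed
  then have fin: "finite (polys_below (Suc j) :: bit poly set)"
  proof (rule finite_subset[OF subsetI])
    show "finite (polys_below j \<union> ?g ` polys_below j)" using Suc by blast
  qed
  then have "card (polys_below (Suc j) :: bit poly set) = 2 * card (polys_below j :: bit poly set)"
    unfolding part[symmetric]
    by (rule card_eq_twice_if_swapped[where g = ?g])
       (auto simp: closed bit_poly_add_add_self)
  then show ?case using fin Suc by simp
qed

lemmas finite_polys_below [simp] = finite_card_polys_below[THEN conjunct1]
lemmas card_polys_below = finite_card_polys_below[THEN conjunct2]

lemma finite_recurrences [simp]: "finite (recurrences j k (c :: bit poly))"
  by (rule finite_subset[of _ "polys_below j"]) (auto simp: recurrences_def)

text \<open>
  Being short imposes two conditions on an element of \<open>K(c)\<close>: its top coefficient vanishes, and so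
  does one value of the functional. Only one of them is effective. If some element has nonzero top
  coefficient, the first condition implies the second; otherwise the first holds throughout, and the
  second fails for some element because not all are short.
\<close>

lemma card_recurrences_short:
  fixes c :: "bit poly"
  assumes nz: "recurrences (n + 1) (n + 1) c \<noteq> {0}"
  shows "card (recurrences (n + 1) (n + 1) c) = 2 * card (recurrences n (n + 2) c)"
proof -
  let ?K = "recurrences (n + 1) (n + 1) c"
  have halve: ?thesis
    if short: "recurrences n (n + 2) c = {v \<in> ?K. P v}"
      and v: "v \<in> ?K" "\<And>u. u \<in> ?K \<Longrightarrow> P (u + v) \<longleftrightarrow> \<not> P u" for P v
    unfolding short
    by (rule card_eq_twice_if_swapped[where g = "\<lambda>u. u + v"])
       (use v in \<open>auto simp: bit_poly_add_add_self intro: recurrences_add\<close>)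
  show ?thesis
  proof (cases "\<exists>v \<in> ?K. coeff v n \<noteq> 0")
    case True
    then obtain v where v: "v \<in> ?K" "coeff v n \<noteq> 0" by blast
    show ?thesis
    proof (rule halve[where P = "\<lambda>u. coeff u n = 0", OF _ v(1)])
      show "recurrences n (n + 2) c = {u \<in> ?K. coeff u n = 0}"
        using recurrences_short_if_long_exists[OF v] recurrences_short_iff[of _ n c] by blast
    qed (use v in auto)
  next
    case False
    let ?f = "\<lambda>u. pairing c (monom 1 (n + 1) * u)"
    from False have short: "recurrences n (n + 2) c = {u \<in> ?K. ?f u = 0}"
      using recurrences_short_iff[of _ n c] by blast
    with recurrences_not_all_short[OF nz] obtain v where v: "v \<in> ?K" "?f v \<noteq> 0" by blast
    show ?thesis
      by (rule halve[OF short v(1)]) (use v(2) in \<open>auto simp: distrib_left pairing_add_right\<close>)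
  qed
qed

text \<open>
  Changing the term of \<open>c\<close> at \<open>degree v + k\<close> toggles the \<open>k\<close>-th condition and leaves the earlier
  ones unaffected, so each further condition halves the number of sequences.
\<close>

lemma card_sequences_satisfying:
  fixes v :: "bit poly"
  assumes "v \<noteq> 0" and "degree v + k \<le> N"
  shows "card {c \<in> polys_below N. \<forall>i<k. pairing c (monom 1 i * v) = 0} * 2 ^ k = 2 ^ N"
  using assms(2)
proof (induction k)
  case 0
  have "{c \<in> polys_below N. \<forall>i<0. pairing c (monom 1 i * v) = 0} = polys_below N"
    by blast
  then show ?case by (simp only: card_polys_below power_0 mult_1_right)
next
  case (Suc k)
  let ?S = "\<lambda>k. {c \<in> polys_below N. \<forall>i<k. pairing c (monom 1 i * v) = 0}"
  let ?m = "monom 1 (degree v + k) :: bit poly"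
  have low: "pairing ?m (monom 1 i * v) = 0" if "i < k" for i
    using that by (simp add: pairing_monom_left coeff_monom_mult coeff_eq_0)
  have top: "pairing ?m (monom 1 k * v) = 1"
    using assms(1) by (simp add: pairing_monom_left coeff_monom_mult)
  have "card (?S k) = 2 * card {c \<in> ?S k. pairing c (monom 1 k * v) = 0}"
  proof (rule card_eq_twice_if_swapped[where g = "\<lambda>c. c + ?m"])
    show "finite (?S k)"
      by (rule finite_subset[OF _ finite_polys_below[of N]]) blast
    show "c + ?m \<in> ?S k" if "c \<in> ?S k" for c
      using that Suc.prems by (auto simp: pairing_add_left low polys_below_def)
  qed (simp_all add: pairing_add_left top bit_poly_add_add_self)
  also have "{c \<in> ?S k. pairing c (monom 1 k * v) = 0} = ?S (Suc k)"
    by (auto simp: less_Suc_eq)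
  finally have "card (?S (Suc k)) * 2 ^ Suc k = card (?S k) * 2 ^ k"
    by (simp only: power_Suc mult_ac)
  also have "\<dots> = 2 ^ N"
    by (rule Suc.IH) (use Suc.prems in linarith)
  finally show ?case .
qed

text \<open>
  Double counting of the pairs \<open>(c, v)\<close>. The bound on \<open>j + k\<close> says that the conditions refer to terms
  of \<open>c\<close> of index less than \<open>N\<close> only.
\<close>

lemma sum_card_recurrences:
  assumes "j + k \<le> N + 1"
  shows "(\<Sum>c\<in>polys_below N. card (recurrences j k (c :: bit poly) - {0})) * 2 ^ k
    = (2 ^ j - 1) * 2 ^ N"
proof -
  let ?ok = "\<lambda>c v :: bit poly. \<forall>i<k. pairing c (monom 1 i * v) = 0"
  let ?V = "polys_below j - {0 :: bit poly}"
  have "(\<Sum>c\<in>polys_below N. card (recurrences j k (c :: bit poly) - {0}))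
      = (\<Sum>c\<in>polys_below N. card {v \<in> ?V. ?ok c v})"
    by (intro sum.cong arg_cong[where f = card]) (auto simp: recurrences_def)
  also have "\<dots> = (\<Sum>v\<in>?V. card {c \<in> polys_below N. ?ok c v})"
    by (rule sum_multicount_gen) auto
  finally have "(\<Sum>c\<in>polys_below N. card (recurrences j k (c :: bit poly) - {0})) * 2 ^ k
      = (\<Sum>v\<in>?V. card {c \<in> polys_below N. ?ok c v} * 2 ^ k)"
    by (simp only: sum_distrib_right)
  also have "\<dots> = (\<Sum>v\<in>?V. 2 ^ N)"
  proof (rule sum.cong[OF refl])
    fix v :: "bit poly" assume "v \<in> ?V"
    then have "v \<noteq> 0" "degree v < j" using degree_less_polys_below by auto
    then show "card {c \<in> polys_below N. ?ok c v} * 2 ^ k = 2 ^ N"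
      using assms by (intro card_sequences_satisfying) auto
  qed
  also have "\<dots> = (2 ^ j - 1) * 2 ^ N"
    by (simp add: card_Diff_singleton card_polys_below)
  finally show ?thesis .
qed

lemma card_sequences_with_recurrence:
  "card {c \<in> polys_below (2 * n + 1). recurrences (n + 1) (n + 1) (c :: bit poly) \<noteq> {0}}
    = 2 ^ (2 * n)"
proof -
  let ?C = "polys_below (2 * n + 1) :: bit poly set"
  let ?sing = "\<lambda>c :: bit poly. recurrences (n + 1) (n + 1) c \<noteq> {0}"
  let ?s = "\<lambda>j k. \<Sum>c\<in>?C. card (recurrences j k c - {0})"
  \<comment> \<open>The nullity cancels, so that each singular matrix is counted once.\<close>
  have pointwise: "card (recurrences (n + 1) (n + 1) c - {0})
      = 2 * card (recurrences n (n + 2) c - {0}) + of_bool (?sing c)" for c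
  proof (cases "?sing c")
    case True
    have "card (recurrences n (n + 2) c) > 0"
      by (auto simp: card_gt_0_iff intro: zero_in_recurrences)
    then show ?thesis
      using True card_recurrences_short[OF True] by (simp add: card_Diff_singleton)
  next
    case False
    then have "recurrences n (n + 2) c \<subseteq> {0}"
      using recurrences_short_iff[of _ n c] by auto
    then have "recurrences n (n + 2) c = {0}"
      using zero_in_recurrences[of n "n + 2" c] by blast
    with False show ?thesis by simp
  qed
  have pow: "(2::nat) ^ (2 * n + 1) = 2 ^ n * 2 ^ (n + 1)"
    by (simp only: mult_2 power_add mult.assoc)
  have cancel: "a = b" if "a * 2 ^ (n + 1) = b * 2 ^ (n + 1)" for a b :: nat
    using that by simp
  have "?s (n + 1) (n + 1) = 2 * ?s n (n + 2) + card {c \<in> ?C. ?sing c}"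
    unfolding pointwise sum.distrib sum_distrib_left[symmetric]
    by (simp add: of_bool_def sum.If_cases Int_def)
  moreover have "?s (n + 1) (n + 1) = (2 ^ (n + 1) - 1) * 2 ^ n"
  proof (rule cancel)
    have "?s (n + 1) (n + 1) * 2 ^ (n + 1) = (2 ^ (n + 1) - 1) * 2 ^ (2 * n + 1)"
      by (rule sum_card_recurrences) simp
    then show "?s (n + 1) (n + 1) * 2 ^ (n + 1) = (2 ^ (n + 1) - 1) * 2 ^ n * 2 ^ (n + 1)"
      by (simp only: pow mult.assoc)
  qed
  moreover have "2 * ?s n (n + 2) = (2 ^ n - 1) * 2 ^ n"
  proof (rule cancel)
    have "2 * ?s n (n + 2) * 2 ^ (n + 1) = ?s n (n + 2) * 2 ^ (n + 2)"
      by (simp only: power_add power_one_right power2_eq_square mult_ac)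
    also have "\<dots> = (2 ^ n - 1) * 2 ^ (2 * n + 1)"
      by (rule sum_card_recurrences) simp
    finally show "2 * ?s n (n + 2) * 2 ^ (n + 1) = (2 ^ n - 1) * 2 ^ n * 2 ^ (n + 1)"
      by (simp only: pow mult.assoc)
  qed
  ultimately have "card {c \<in> ?C. ?sing c} + (2 ^ n - 1) * 2 ^ n = (2 ^ (n + 1) - 1) * 2 ^ n"
    by simp
  also have "\<dots> = 2 ^ (2 * n) + (2 ^ n - 1) * (2::nat) ^ n"
  proof -
    have "(2::nat) ^ (n + 1) - 1 = 2 ^ n + (2 ^ n - 1)" by simp
    then show ?thesis by (simp only: distrib_right mult_2 power_add)
  qed
  finally show ?thesis by simp
qed

section \<open>Toeplitz matrices as sequences\<close>

text \<open>
  The diagonals are numbered from the bottom left corner, so \<open>b\<^sub>n, \<dots>, b\<^sub>1, a\<^sub>0, \<dots>, a\<^sub>n\<close> become the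
  coefficients \<open>0, \<dots>, 2 n\<close> of \<open>c\<close>.
\<close>

definition toeplitz_of :: "nat \<Rightarrow> 'a::zero poly \<Rightarrow> 'a mat" where
  "toeplitz_of n c = mat (n + 1) (n + 1) (\<lambda>(i, j). coeff c (n + j - i))"

lemma exists_polys_below_coeff:
  "\<exists>c \<in> polys_below m. \<forall>i<m. coeff c i = (f i :: 'a::comm_monoid_add)"
proof (intro bexI allI impI)
  show "coeff (poly_of_list (map f [0..<m])) i = f i" if "i < m" for i
    using that by (simp add: nth_default_def)
  show "poly_of_list (map f [0..<m]) \<in> polys_below m"
    by (simp add: polys_below_def nth_default_def)
qed

lemma toeplitz_mats_eq_image:
  "(toeplitz_mats n :: 'a::comm_monoid_add mat set) = toeplitz_of n ` polys_below (2 * n + 1)"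
proof (intro equalityI subsetI)
  fix A :: "'a mat" assume "A \<in> toeplitz_mats n"
  then obtain a b where A: "A = toeplitz_mat n a b" by (auto simp: toeplitz_mats_def)
  obtain c :: "'a poly" where c: "c \<in> polys_below (2 * n + 1)"
    and ceq: "\<And>i. i < 2 * n + 1 \<Longrightarrow> coeff c i = (if i \<ge> n then a (i - n) else b (n - i))"
    using exists_polys_below_coeff[of "2 * n + 1" "\<lambda>i. if i \<ge> n then a (i - n) else b (n - i)"]
    by blast
  have "A = toeplitz_of n c"
    unfolding A toeplitz_mat_def toeplitz_of_def by (rule eq_matI) (auto simp: ceq)
  then show "A \<in> toeplitz_of n ` polys_below (2 * n + 1)" using c by blast
next
  fix A :: "'a mat" assume "A \<in> toeplitz_of n ` polys_below (2 * n + 1)"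
  then obtain c where A: "A = toeplitz_of n c" by blast
  have "A = toeplitz_mat n (\<lambda>k. coeff c (n + k)) (\<lambda>k. coeff c (n - k))"
    unfolding A toeplitz_mat_def toeplitz_of_def by (rule eq_matI) auto
  then show "A \<in> toeplitz_mats n" by (auto simp: toeplitz_mats_def)
qed

lemma inj_on_toeplitz_of: "inj_on (toeplitz_of n) (polys_below (2 * n + 1))"
proof (rule inj_onI, rule poly_eqI)
  fix c d :: "'a poly" and k
  assume c: "c \<in> polys_below (2 * n + 1)" and d: "d \<in> polys_below (2 * n + 1)"
    and eq: "toeplitz_of n c = toeplitz_of n d"
  have entry: "coeff c (n + j - i) = coeff d (n + j - i)" if "i \<le> n" "j \<le> n" for i j
    using arg_cong[OF eq, of "\<lambda>A. A $$ (i, j)"] that by (simp add: toeplitz_of_def)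
  consider "k \<le> n" | "n < k" "k \<le> 2 * n" | "2 * n < k" by linarith
  then show "coeff c k = coeff d k"
  proof cases
    case 1
    then show ?thesis using entry[of "n - k" 0] by simp
  next
    case 2
    then show ?thesis using entry[of 0 "k - n"] by simp
  next
    case 3
    then show ?thesis using c d by (simp add: polys_below_def)
  qed
qed

lemma pairing_monom_mult_eq_sum:
  assumes "v \<in> polys_below (n + 1)"
  shows "pairing c (monom 1 i * v) = (\<Sum>j\<le>n. coeff c (i + j) * coeff v j)"
proof -
  have "degree v \<le> n"
    using assms by (auto simp: polys_below_def intro!: degree_le)
  then have "degree (monom 1 i * v) \<le> i + n"
    using degree_mult_le[of "monom 1 i" v] degree_monom_le[of "1 :: 'a" i] by linarith
  then have "pairing c (monom 1 i * v) = (\<Sum>j\<in>{..i + n}. coeff c j * coeff (monom 1 i * v) j)"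
    by (rule pairing_eq_sum)
  also have "\<dots> = (\<Sum>j\<in>{i..i + n}. coeff c j * coeff (monom 1 i * v) j)"
    by (rule sum.mono_neutral_right) (auto simp: coeff_monom_mult)
  also have "\<dots> = (\<Sum>j\<le>n. coeff c (i + j) * coeff v j)"
    by (rule sum.reindex_bij_witness[of _ "\<lambda>j. i + j" "\<lambda>j. j - i"]) (auto simp: coeff_monom_mult)
  finally show ?thesis .
qed

text \<open>
  Row \<open>i\<close> of the matrix applies the functional to \<open>x\<^bsup>n-i\<^esup> v\<close>; reversing the order of the rows gives
  the conditions defining \<open>recurrences\<close>.
\<close>

lemma toeplitz_of_mult_vec_eq_0_iff:
  assumes "v \<in> polys_below (n + 1)"
  shows "toeplitz_of n c *\<^sub>v vec (n + 1) (coeff v) = 0\<^sub>v (n + 1)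
    \<longleftrightarrow> v \<in> recurrences (n + 1) (n + 1) c"
proof -
  have entry: "(toeplitz_of n c *\<^sub>v vec (n + 1) (coeff v)) $ i = pairing c (monom 1 (n - i) * v)"
    if "i \<le> n" for i
    using that
    by (simp add: toeplitz_of_def pairing_monom_mult_eq_sum[OF assms] scalar_prod_def
        atLeast0LessThan lessThan_Suc_atMost del: sum.op_ivl_Suc sum.lessThan_Suc)
  have "toeplitz_of n c *\<^sub>v vec (n + 1) (coeff v) = 0\<^sub>v (n + 1)
      \<longleftrightarrow> (\<forall>i\<le>n. (toeplitz_of n c *\<^sub>v vec (n + 1) (coeff v)) $ i = 0)"
    by (simp add: vec_eq_iff toeplitz_of_def less_Suc_eq_le)
  also have "\<dots> \<longleftrightarrow> (\<forall>i\<le>n. pairing c (monom 1 (n - i) * v) = 0)"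
    using entry by presburger
  also have "\<dots> \<longleftrightarrow> (\<forall>i\<le>n. pairing c (monom 1 i * v) = 0)"
    by (metis diff_diff_cancel diff_le_self)
  finally show ?thesis using assms by (simp add: recurrences_def less_Suc_eq_le)
qed

lemma invertible_mat_iff_trivial_kernel:
  fixes A :: "'a::field mat"
  assumes A: "A \<in> carrier_mat m m"
  shows "invertible_mat A \<longleftrightarrow> (\<forall>x \<in> carrier_vec m. A *\<^sub>v x = 0\<^sub>v m \<longrightarrow> x = 0\<^sub>v m)"
proof
  assume "invertible_mat A"
  then obtain B where BA: "inverts_mat B A" and AB: "inverts_mat A B"
    by (auto simp: invertible_mat_def)
  have B: "B \<in> carrier_mat m m"
    using A AB BA unfolding inverts_mat_def
    by (metis carrier_matD(1,2) carrier_matI index_mult_mat(3) index_one_mat(3))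
  show "\<forall>x \<in> carrier_vec m. A *\<^sub>v x = 0\<^sub>v m \<longrightarrow> x = 0\<^sub>v m"
  proof (intro ballI impI)
    fix x assume x: "x \<in> carrier_vec m" and Ax: "A *\<^sub>v x = 0\<^sub>v m"
    have "x = (B * A) *\<^sub>v x" using BA B x by (simp add: inverts_mat_def)
    also have "\<dots> = B *\<^sub>v (A *\<^sub>v x)" by (rule assoc_mult_mat_vec[OF B A x])
    also have "\<dots> = 0\<^sub>v m" unfolding Ax using B by (intro eq_vecI) auto
    finally show "x = 0\<^sub>v m" .
  qed
next
  assume "\<forall>x \<in> carrier_vec m. A *\<^sub>v x = 0\<^sub>v m \<longrightarrow> x = 0\<^sub>v m"
  then have "det A \<noteq> 0" using det_0_iff_vec_prod_zero_field[OF A] by blast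
  from det_non_zero_imp_unit[OF A this, of "()"]
  obtain B where "B \<in> carrier_mat m m" "B * A = 1\<^sub>m m" "A * B = 1\<^sub>m m"
    by (auto simp: Units_def ring_mat_def)
  then show "invertible_mat A"
    using A by (auto simp: invertible_mat_def inverts_mat_def)
qed

lemma invertible_toeplitz_of_iff:
  fixes c :: "'a::field poly"
  shows "invertible_mat (toeplitz_of n c) \<longleftrightarrow> recurrences (n + 1) (n + 1) c = {0}"
proof -
  let ?vec = "\<lambda>v :: 'a poly. vec (n + 1) (coeff v)"
  let ?V = "polys_below (n + 1) :: 'a poly set"
  have onto: "carrier_vec (n + 1) = ?vec ` ?V"
  proof (intro equalityI subsetI)
    fix x :: "'a vec" assume x: "x \<in> carrier_vec (n + 1)"
    obtain v where "v \<in> ?V" "\<forall>i<n + 1. coeff v i = x $ i"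
      using exists_polys_below_coeff[of "n + 1" "\<lambda>i. x $ i"] by blast
    then show "x \<in> ?vec ` ?V"
      using x by (intro image_eqI[of _ _ v]) auto
  qed auto
  have zero: "?vec v = 0\<^sub>v (n + 1) \<longleftrightarrow> v = 0" if "v \<in> ?V" for v
  proof
    assume z: "?vec v = 0\<^sub>v (n + 1)"
    have "coeff v i = 0" for i
    proof (cases "i < n + 1")
      case True
      then show ?thesis using arg_cong[OF z, of "\<lambda>x. x $ i"] by simp
    next
      case False
      then show ?thesis using that by (simp add: polys_below_def)
    qed
    then show "v = 0" by (simp add: poly_eq_iff)
  qed auto
  have carrier: "toeplitz_of n c \<in> carrier_mat (n + 1) (n + 1)"
    by (simp add: toeplitz_of_def)
  have "invertible_mat (toeplitz_of n c)
      \<longleftrightarrow> (\<forall>v \<in> ?V. toeplitz_of n c *\<^sub>v ?vec v = 0\<^sub>v (n + 1) \<longrightarrow> ?vec v = 0\<^sub>v (n + 1))"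
    unfolding invertible_mat_iff_trivial_kernel[OF carrier] onto by blast
  also have "\<dots> \<longleftrightarrow> (\<forall>v \<in> ?V. v \<in> recurrences (n + 1) (n + 1) c \<longrightarrow> v = 0)"
    using toeplitz_of_mult_vec_eq_0_iff[of _ n c] zero by blast
  also have "\<dots> \<longleftrightarrow> recurrences (n + 1) (n + 1) c = {0}"
    using zero_in_recurrences[of "n + 1" "n + 1" c] by (auto simp: recurrences_def)
  finally show ?thesis .
qed

theorem theorem14:
  fixes n :: nat
  shows "card {A \<in> (toeplitz_mats n :: bit mat set). invertible_mat A} = 2 ^ (2 * n)
    \<and> 2 * card {A \<in> (toeplitz_mats n :: bit mat set). invertible_mat A}
        = card (toeplitz_mats n :: bit mat set)"
proof -
  let ?C = "polys_below (2 * n + 1) :: bit poly set"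
  let ?sing = "\<lambda>c :: bit poly. recurrences (n + 1) (n + 1) c \<noteq> {0}"
  have all: "card (toeplitz_mats n :: bit mat set) = 2 ^ (2 * n + 1)"
    by (simp add: toeplitz_mats_eq_image card_image inj_on_toeplitz_of card_polys_below
        del: One_nat_def)
  have "{A \<in> (toeplitz_mats n :: bit mat set). invertible_mat A}
      = toeplitz_of n ` (?C - {c \<in> ?C. ?sing c})"
    by (auto simp: toeplitz_mats_eq_image invertible_toeplitz_of_iff)
  then have "card {A \<in> (toeplitz_mats n :: bit mat set). invertible_mat A}
      = card (?C - {c \<in> ?C. ?sing c})"
    by (simp add: card_image inj_on_subset[OF inj_on_toeplitz_of])
  also have "\<dots> = card ?C - card {c \<in> ?C. ?sing c}"
    by (rule card_Diff_subset) auto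
  also have "\<dots> = 2 ^ (2 * n + 1) - 2 ^ (2 * n)"
    by (simp only: card_sequences_with_recurrence card_polys_below)
  finally show ?thesis using all by simp
qed

end
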